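(* If $n\ge 3$, then (i) $\mu^{-}_t(S(K_n))=0$, and (ii) $\mu^{-}(S(K_n))=n$.
   Context: $S(K_n)$ is the graph obtained from the complete graph $K_n$ by subdividing each edge exactly once. For $X\subseteq V(G)$, two vertices $a,b$ are $X$-visible if there is a shortest $a,b$-path $P$ with $V(P)\cap X\subseteq\{a,b\}$. $X$ is a mutual-visibility set if every two vertices of $X$ are $X$-visible, and a total mutual-visibility set if every two vertices of $G$ are $X$-visible; such a set is maximal if no proper superset has the same property (the empty set is allowed as a total mutual-visibility set). $\mu^{-}(G)$ (resp. $\mu^{-}_t(G)$) is the minimum cardinality of a maximal mutual-visibility (resp. maximal total mutual-visibility) set. *)

theory Defs
  imports "Graph_Theory.Graph_Theory"
begin

text \<open>
  A finite simple graph is a symmetric loop-free digraph (\<^locale>\<open>pair_graph\<close>), each undirected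
  edge being a pair of opposite arcs.
\<close>

definition edges :: "'a pair_pre_digraph \<Rightarrow> 'a set set" where
  "edges G = (\<lambda>(u, v). {u, v}) ` parcs G"

text \<open>
  The vertex \<open>Inr {u, v}\<close> is the one that subdivides the edge \<open>uv\<close>; it replaces this edge by the
  path \<open>Inl u, Inr {u, v}, Inl v\<close>.
\<close>

definition edge_subdivision :: "'a pair_pre_digraph \<Rightarrow> ('a + 'a set) pair_pre_digraph" where
  "edge_subdivision G =
    \<lparr> pverts = Inl ` pverts G \<union> Inr ` edges G,
      parcs = {(Inl u, Inr e) |u e. e \<in> edges G \<and> u \<in> e} \<union>
              {(Inr e, Inl u) |u e. e \<in> edges G \<and> u \<in> e} \<rparr>"

lemma pair_graph_edge_subdivision:
  assumes "pair_graph G"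
  shows "pair_graph (edge_subdivision G)"
proof -
  interpret pair_graph G by fact
  have fin_edges: "finite (edges G)"
    by (simp add: edges_def)
  have edges_verts: "u \<in> pverts G" if "e \<in> edges G" "u \<in> e" for u e
    using that by (auto simp: edges_def dest: in_arcsD1 in_arcsD2)
  have "parcs (edge_subdivision G) \<subseteq> pverts (edge_subdivision G) \<times> pverts (edge_subdivision G)"
    by (auto simp: edge_subdivision_def intro: edges_verts)
  moreover have "finite (pverts (edge_subdivision G))"
    by (simp add: edge_subdivision_def fin_edges)
  moreover from calculation have "finite (parcs (edge_subdivision G))"
    by (meson finite_SigmaI finite_subset)
  moreover have "sym (parcs (edge_subdivision G))"
    by (auto simp: edge_subdivision_def sym_def)
  moreover have "fst a \<noteq> snd a" if "a \<in> parcs (edge_subdivision G)" for a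
    using that by (auto simp: edge_subdivision_def)
  ultimately show ?thesis
    by unfold_locales (auto simp: symmetric_def)
qed

definition shortest_vpath :: "('a, 'b) pre_digraph \<Rightarrow> 'a \<Rightarrow> 'a vwalk \<Rightarrow> 'a \<Rightarrow> bool" where
  "shortest_vpath G a p b \<longleftrightarrow>
    vpath p G \<and> hd p = a \<and> last p = b \<and>
    (\<forall>q. vpath q G \<and> hd q = a \<and> last q = b \<longrightarrow> vwalk_length p \<le> vwalk_length q)"

definition visible :: "('a, 'b) pre_digraph \<Rightarrow> 'a set \<Rightarrow> 'a \<Rightarrow> 'a \<Rightarrow> bool" where
  "visible G X a b \<longleftrightarrow> (\<exists>p. shortest_vpath G a p b \<and> set p \<inter> X \<subseteq> {a, b})"

definition mutual_visibility_set :: "('a, 'b) pre_digraph \<Rightarrow> 'a set \<Rightarrow> bool" where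
  "mutual_visibility_set G X \<longleftrightarrow>
    X \<subseteq> verts G \<and> (\<forall>a\<in>X. \<forall>b\<in>X. a \<noteq> b \<longrightarrow> visible G X a b)"

definition total_mutual_visibility_set :: "('a, 'b) pre_digraph \<Rightarrow> 'a set \<Rightarrow> bool" where
  "total_mutual_visibility_set G X \<longleftrightarrow>
    X \<subseteq> verts G \<and> (\<forall>a\<in>verts G. \<forall>b\<in>verts G. a \<noteq> b \<longrightarrow> visible G X a b)"

definition maximal_set :: "('a set \<Rightarrow> bool) \<Rightarrow> 'a set \<Rightarrow> bool" where
  "maximal_set P X \<longleftrightarrow> P X \<and> (\<forall>Y. X \<subset> Y \<longrightarrow> \<not> P Y)"

text \<open>The two minima below are meaningful for finite connected graphs.\<close>

definition lower_mu :: "('a, 'b) pre_digraph \<Rightarrow> nat" where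
  "lower_mu G = Min (card ` {X. maximal_set (mutual_visibility_set G) X})"

definition lower_mu_t :: "('a, 'b) pre_digraph \<Rightarrow> nat" where
  "lower_mu_t G = Min (card ` {X. maximal_set (total_mutual_visibility_set G) X})"

end

theory Submission
  imports Defs
begin

text \<open>
  Any single vertex of \<open>S(K\<^sub>n)\<close> is the unique midpoint of some shortest path, so only the empty set is
  totally mutually visible. The \<open>n\<close> original vertices form a maximal mutual-visibility set. Conversely,
  let \<open>X\<close> be a mutual-visibility set with fewer than \<open>n\<close> elements, consisting of the original vertices
  \<open>U\<close> and the subdivision vertices of the edges \<open>F\<close>. As \<open>|U| + |F| < n\<close>, the graph \<open>(V, F)\<close> has more than
  \<open>|U|\<close> tree components, hence one that avoids \<open>U\<close>; a vertex of degree at most one in it can be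
  added to \<open>X\<close>.
\<close>

section \<open>Paths as vertex lists, and visibility at a known distance\<close>

lemma vpath_Cons_Cons:
  "vpath (x # y # p) H \<longleftrightarrow>
    x \<in> verts H \<and> (x, y) \<in> arcs_ends H \<and> x \<noteq> y \<and> x \<notin> set p \<and> vpath (y # p) H"
  by (auto simp: vpath_def vwalk_def)

lemma vpath_singleton: "vpath [x] H \<longleftrightarrow> x \<in> verts H"
  by (auto simp: vpath_def vwalk_def)

lemmas vpath_simps = vpath_Cons_Cons vpath_singleton

text \<open>The path \<open>p\<close> attains the lower bound \<open>k\<close>, so the shortest
  paths are exactly those with \<open>k\<close> vertices. Visibility becomes a search among lists of
  fixed length. Note that \<open>k\<close> counts vertices, whereas \<open>vwalk_length\<close>
  counts arcs.\<close>

lemma visible_iff_of_distance: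
  assumes "vpath p G" "hd p = a" "last p = b" "length p = k"
    and "\<And>q. vpath q G \<Longrightarrow> hd q = a \<Longrightarrow> last q = b \<Longrightarrow> k \<le> length q"
  shows "visible G X a b \<longleftrightarrow>
    (\<exists>q. vpath q G \<and> hd q = a \<and> last q = b \<and> length q = k \<and> set q \<inter> X \<subseteq> {a, b})"
proof
  assume "visible G X a b"
  then obtain q where q: "shortest_vpath G a q b" "set q \<inter> X \<subseteq> {a, b}"
    by (auto simp: visible_def)
  then have path: "vpath q G" "hd q = a" "last q = b" and "length q - 1 \<le> length p - 1"
    using assms(1-3) by (auto simp: shortest_vpath_def)
  \<comment> \<open>Arc counts are truncated differences \<open>length - 1\<close>, so comparing
    them compares vertex counts only for nonempty lists.\<close>
  moreover have "p \<noteq> []" "q \<noteq> []"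
    using assms(1) path(1) by (auto simp: vpath_def vwalk_def)
  ultimately have "length q \<le> k"
    using assms(4) by (cases p; cases q) auto
  then have "length q = k"
    using assms(5)[OF path] by simp
  with path q(2) show "\<exists>q. vpath q G \<and> hd q = a \<and> last q = b \<and> length q = k \<and> set q \<inter> X \<subseteq> {a, b}"
    by blast
next
  assume "\<exists>q. vpath q G \<and> hd q = a \<and> last q = b \<and> length q = k \<and> set q \<inter> X \<subseteq> {a, b}"
  then obtain q where q: "vpath q G" "hd q = a" "last q = b" "length q = k" "set q \<inter> X \<subseteq> {a, b}"
    by blast
  then show "visible G X a b"
    unfolding visible_def shortest_vpath_def using assms(5) by (auto intro!: exI[of _ q] diff_le_mono)
qed

section \<open>Sparse graphs: a component avoiding a small vertex set\<close>

text \<open>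
  Here \<open>T\<close> is the tree component that avoids \<open>U\<close>. It is obtained as a minimal set of vertices with
  more elements than incident edges and elements of \<open>U\<close> together.
\<close>

lemma sparse_graph_leaf:
  fixes F :: "'v set set"
  assumes finV: "finite V" and finU: "finite U" and finF: "finite F"
    and card2: "\<And>e. e \<in> F \<Longrightarrow> card e = 2"
    and sparse: "card U + card F < card V"
  obtains T w where "T \<subseteq> V" "T \<inter> U = {}" "w \<in> T"
    "\<forall>e\<in>F. e \<inter> T \<noteq> {} \<longrightarrow> e \<subseteq> T"
    "\<forall>e\<in>F. \<forall>f\<in>F. w \<in> e \<longrightarrow> w \<in> f \<longrightarrow> e = f"
    "\<forall>x\<in>T. \<forall>y z. {x, y} \<in> F \<longrightarrow> {x, z} \<in> F \<longrightarrow> {y, z} \<notin> F"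
proof -
  define inc where "inc T = {e \<in> F. e \<inter> T \<noteq> {}}" for T
  \<comment> \<open>The excess of vertices over marked vertices and edges, required to be positive.
    \<open>inc T\<close> counts every edge that meets \<open>T\<close>, so an edge leaves the count
    only when all its ends in \<open>T\<close> are deleted.\<close>
  define P where "P T \<longleftrightarrow> T \<subseteq> V \<and> card (U \<inter> T) + card (inc T) < card T" for T
  have fin_inc: "finite (inc T)" for T
    using finF by (simp add: inc_def)
  have inc_mono: "card (inc T) \<le> card (inc T')" if "T \<subseteq> T'" for T T'
    using that by (intro card_mono fin_inc) (auto simp: inc_def)
  have "card (U \<inter> V) \<le> card U" "card (inc V) \<le> card F"
    using finU finF by (auto simp: inc_def intro: card_mono)
  then have "P V"
    using sparse by (simp add: P_def)
  moreover have "finite {T. P T}"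
    by (rule finite_subset[of _ "Pow V"]) (auto simp: P_def finV)
  ultimately obtain T where "P T" and min: "\<And>T'. P T' \<Longrightarrow> T' \<subseteq> T \<Longrightarrow> T' = T"
    using finite_has_minimal[of "{T. P T}"] by fastforce
  then have TV: "T \<subseteq> V" and T: "card (U \<inter> T) + card (inc T) < card T"
    by (auto simp: P_def)
  have finT: "finite T" using TV finV by (rule finite_subset)
  \<comment> \<open>Minimality as an inequality: deleting one vertex must destroy the positive
    excess.\<close>
  have del: "card T \<le> Suc (card (U \<inter> (T - {v})) + card (inc (T - {v})))" if "v \<in> T" for v
  proof -
    have "\<not> P (T - {v})" using min[of "T - {v}"] that by blast
    then have "card (T - {v}) \<le> card (U \<inter> (T - {v})) + card (inc (T - {v}))"
      using TV by (auto simp: P_def)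
    then show ?thesis using that by simp
  qed
  have TU: "T \<inter> U = {}"
  proof (rule ccontr)
    assume "T \<inter> U \<noteq> {}"
    then obtain v where v: "v \<in> T" "v \<in> U" by blast
    \<comment> \<open>Deleting a vertex of \<open>U\<close> lowers both sides of the strict
      inequality, which would therefore survive.\<close>
    have "U \<inter> (T - {v}) \<subset> U \<inter> T" using v by blast
    then have "card (U \<inter> (T - {v})) < card (U \<inter> T)"
      using finU by (intro psubset_card_mono) auto
    with del[OF v(1)] T inc_mono[of "T - {v}" T] show False by auto
  qed
  \<comment> \<open>Now \<open>card (inc T) < card T \<le> Suc (card (inc (T - {v}))) \<le> Suc
    (card (inc T))\<close>, which leaves no slack: the excess is exactly one, and deleting a vertex
    loses no incident edge.\<close>
  have card_T: "card T = Suc (card (inc T))"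
    and inc_del: "inc (T - {v}) = inc T" if "v \<in> T" for v
  proof -
    have "U \<inter> (T - {v}) = {}" using TU by blast
    with del[OF that] T have *: "card (inc T) \<le> card (inc (T - {v}))" by simp
    then show "inc (T - {v}) = inc T"
      by (intro card_seteq fin_inc) (auto simp: inc_def)
    then show "card T = Suc (card (inc T))"
      using del[OF that] T \<open>U \<inter> (T - {v}) = {}\<close> by simp
  qed
  have closed: "e \<subseteq> T" if e: "e \<in> F" "e \<inter> T \<noteq> {}" for e
  proof -
    obtain v where v: "v \<in> e" "v \<in> T" using e(2) by blast
    \<comment> \<open>The edge still meets \<open>T\<close> without \<open>v\<close>, so its second
      end lies in \<open>T\<close> too.\<close>
    then have "e \<in> inc (T - {v})" using inc_del[OF v(2)] e by (simp add: inc_def)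
    then obtain v' where v': "v' \<in> e" "v' \<in> T" "v' \<noteq> v" by (auto simp: inc_def)
    have "finite e" using card2[OF e(1)] by (simp add: card_ge_0_finite)
    then have "{v, v'} = e"
      using v v' card2[OF e(1)] by (intro card_subset_eq) auto
    with v v' show ?thesis by blast
  qed
  have "T \<noteq> {}" using T by auto
  then have card_T': "card T = Suc (card (inc T))" using card_T by blast
  \<comment> \<open>Handshake argument: if all degrees were at least two, double counting would give
    \<open>card T \<le> card (inc T)\<close>.\<close>
  have "\<exists>w\<in>T. card {e \<in> inc T. w \<in> e} \<le> 1"
  proof (rule ccontr)
    assume "\<not> (\<exists>w\<in>T. card {e \<in> inc T. w \<in> e} \<le> 1)"
    then have "(\<Sum>w\<in>T. 2) \<le> (\<Sum>w\<in>T. card {e \<in> inc T. w \<in> e})"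
      by (intro sum_mono) force
    also have "\<dots> = 2 * card (inc T)"
    proof (rule sum_multicount[OF finT fin_inc], rule ballI)
      fix e assume e: "e \<in> inc T"
      then have "{w \<in> T. w \<in> e} = e" using closed by (auto simp: inc_def)
      then show "card {w \<in> T. w \<in> e} = 2" using card2 e by (simp add: inc_def)
    qed
    finally show False using card_T' by simp
  qed
  then obtain w where w: "w \<in> T" "card {e \<in> inc T. w \<in> e} \<le> 1" by blast
  have leaf: "e = f" if "e \<in> F" "f \<in> F" "w \<in> e" "w \<in> f" for e f
  proof -
    have "e \<in> {e \<in> inc T. w \<in> e}" "f \<in> {e \<in> inc T. w \<in> e}"
      using that w(1) by (auto simp: inc_def)
    moreover have "finite {e \<in> inc T. w \<in> e}" using fin_inc by simp
    ultimately show ?thesis using w(2) card_le_Suc0_iff_eq by (metis One_nat_def)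
  qed
  \<comment> \<open>Removing a triangle costs three vertices and at least three edges, so the excess
    stays positive on a smaller set, against minimality.\<close>
  have no_triangle: "{y, z} \<notin> F" if x: "x \<in> T" "{x, y} \<in> F" "{x, z} \<in> F" for x y z
  proof
    assume yz: "{y, z} \<in> F"
    have ne: "x \<noteq> y" "x \<noteq> z" "y \<noteq> z"
      using card2[OF x(2)] card2[OF x(3)] card2[OF yz] by auto
    have sub: "{x, y, z} \<subseteq> T"
      using closed[OF x(2)] closed[OF x(3)] x(1) by auto
    have tri: "{{x, y}, {x, z}, {y, z}} \<subseteq> inc T"
      using x yz sub by (auto simp: inc_def)
    have "card {{x, y}, {x, z}, {y, z}} = 3"
      using ne by (auto simp: doubleton_eq_iff)
    then have "card (inc T - {{x, y}, {x, z}, {y, z}}) = card (inc T) - 3"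
      using tri by (simp add: card_Diff_subset)
    moreover have "inc (T - {x, y, z}) \<subseteq> inc T - {{x, y}, {x, z}, {y, z}}"
      by (auto simp: inc_def)
    then have "card (inc (T - {x, y, z})) \<le> card (inc T - {{x, y}, {x, z}, {y, z}})"
      using fin_inc by (intro card_mono) auto
    \<comment> \<open>This keeps the truncated differences exact, so that
      \<open>card (inc T) - 3 < card T - 3\<close>.\<close>
    moreover have "3 \<le> card (inc T)"
      using card_mono[OF fin_inc tri] \<open>card {{x, y}, {x, z}, {y, z}} = 3\<close> by simp
    moreover have "card (T - {x, y, z}) = card T - 3"
      using sub ne by (simp add: card_Diff_subset)
    moreover have "U \<inter> (T - {x, y, z}) = {}" using TU by blast
    ultimately have "P (T - {x, y, z})"
      using card_T' TV by (auto simp: P_def)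
    then show False using min[of "T - {x, y, z}"] x(1) by blast
  qed
  show thesis
    by (rule that[OF TV TU w(1)]) (use closed leaf no_triangle in auto)
qed

section \<open>The subdivided complete graph\<close>

locale complete_subdivision =
  fixes n :: nat and G :: "'a pair_pre_digraph"
  assumes complete: "complete_digraph n (with_proj G)"
begin

abbreviation V where "V \<equiv> pverts G"
abbreviation E where "E \<equiv> edges G"
abbreviation S where "S \<equiv> with_proj (edge_subdivision G)"

lemma finite_V: "finite V" and card_V: "card V = n"
  using complete by (auto simp: complete_digraph_pair_def)

lemma edge_iff: "{u, v} \<in> E \<longleftrightarrow> u \<in> V \<and> v \<in> V \<and> u \<noteq> v"
proof -
  have "parcs G = {(u, v). (u, v) \<in> V \<times> V \<and> u \<noteq> v}"
    using complete by (simp add: complete_digraph_pair_def)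
  then show ?thesis
    by (auto simp: edges_def doubleton_eq_iff image_iff)
qed

lemma edgeE:
  assumes "e \<in> E"
  obtains u v where "e = {u, v}" "u \<in> V" "v \<in> V" "u \<noteq> v"
proof -
  have "parcs G = {(u, v). (u, v) \<in> V \<times> V \<and> u \<noteq> v}"
    using complete by (simp add: complete_digraph_pair_def)
  with assms show thesis
    using that by (auto simp: edges_def)
qed

lemma edge_subset: "e \<in> E \<Longrightarrow> u \<in> e \<Longrightarrow> u \<in> V"
  by (auto elim: edgeE)

lemma edge_eq: "e \<in> E \<Longrightarrow> u \<in> e \<Longrightarrow> v \<in> e \<Longrightarrow> u \<noteq> v \<Longrightarrow> e = {u, v}"
  by (auto elim!: edgeE)

lemma edge_other_end:
  assumes "e \<in> E" "u \<in> e"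
  obtains v where "e = {u, v}" "v \<noteq> u"
  using assms by (auto elim!: edgeE)

lemma card_edge: "e \<in> E \<Longrightarrow> card e = 2"
  by (auto elim!: edgeE)

lemma verts_S [simp]:
  "Inl u \<in> pverts (edge_subdivision G) \<longleftrightarrow> u \<in> V"
  "Inr e \<in> pverts (edge_subdivision G) \<longleftrightarrow> e \<in> E"
  by (auto simp: edge_subdivision_def)

lemma arcs_S [simp]:
  "(Inl u, Inr e) \<in> parcs (edge_subdivision G) \<longleftrightarrow> e \<in> E \<and> u \<in> e"
  "(Inr e, Inl u) \<in> parcs (edge_subdivision G) \<longleftrightarrow> e \<in> E \<and> u \<in> e"
  "(Inl u, Inl v) \<notin> parcs (edge_subdivision G)"
  "(Inr e, Inr f) \<notin> parcs (edge_subdivision G)"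
  by (auto simp: edge_subdivision_def)

lemma finite_verts_S: "finite (pverts (edge_subdivision G))"
proof -
  have "pair_graph G"
    using complete by (rule pair_graphI_complete)
  then interpret S: pair_graph "edge_subdivision G"
    by (rule pair_graph_edge_subdivision)
  show ?thesis by simp
qed

section \<open>Lower bounds for distances, counted in vertices\<close>

lemma vpath_length_Inl_Inl:
  assumes "vpath q S" "hd q = Inl u" "last q = Inl v" "u \<noteq> v"
  shows "3 \<le> length q"
proof (rule ccontr)
  assume "\<not> 3 \<le> length q"
  then have "length q = 0 \<or> length q = 1 \<or> length q = 2" by linarith
  with assms show False
    by (auto simp: length_Suc_conv numeral_eq_Suc vpath_simps vpath_def[of "[]"] vwalk_def[of "[]"])
qed

lemma vpath_length_Inl_Inr:
  assumes "vpath q S" "hd q = Inl u" "last q = Inr e" "u \<notin> e"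
  shows "4 \<le> length q"
proof (rule ccontr)
  assume "\<not> 4 \<le> length q"
  then have "length q = 0 \<or> length q = 1 \<or> length q = 2 \<or> length q = 3" by linarith
  \<comment> \<open>Arcs of \<open>S\<close> join vertices of different kinds only, so no inner
    vertex can be adjacent to both \<open>Inl u\<close> and \<open>Inr e\<close>.\<close>
  moreover have "(Inl u, x) \<notin> parcs (edge_subdivision G) \<or> (x, Inr e) \<notin> parcs (edge_subdivision G)" for x
    by (cases x) auto
  ultimately show False using assms
    by (auto simp: length_Suc_conv numeral_eq_Suc vpath_simps vpath_def[of "[]"] vwalk_def[of "[]"])
qed

lemma vpath_length_Inr_Inr:
  assumes "vpath q S" "hd q = Inr e" "last q = Inr f" "e \<noteq> f"
  shows "3 \<le> length q"
proof (rule ccontr)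
  assume "\<not> 3 \<le> length q"
  then have "length q = 0 \<or> length q = 1 \<or> length q = 2" by linarith
  with assms show False
    by (auto simp: length_Suc_conv numeral_eq_Suc vpath_simps vpath_def[of "[]"] vwalk_def[of "[]"])
qed

lemma vpath_length_Inr_Inr_disjoint:
  assumes "vpath q S" "hd q = Inr e" "last q = Inr f" "e \<noteq> f" "e \<inter> f = {}"
  shows "5 \<le> length q"
proof (rule ccontr)
  assume "\<not> 5 \<le> length q"
  moreover have "3 \<le> length q"
    using assms by (intro vpath_length_Inr_Inr)
  ultimately have "length q = 3 \<or> length q = 4" by linarith
  \<comment> \<open>With three vertices, the middle one would be a common end of \<open>e\<close>
    and \<open>f\<close>. With four, the two kinds could not alternate between ends of the same
    kind.\<close>
  moreover have "(Inr e, x) \<notin> parcs (edge_subdivision G) \<or> (x, Inr f) \<notin> parcs (edge_subdivision G)" for x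
    using assms(5) by (cases x) auto
  moreover have "(Inr e, x) \<notin> parcs (edge_subdivision G) \<or> (x, y) \<notin> parcs (edge_subdivision G)
      \<or> (y, Inr f) \<notin> parcs (edge_subdivision G)" for x y
    by (cases x; cases y) auto
  ultimately show False using assms
    by (auto simp: length_Suc_conv numeral_eq_Suc vpath_simps vpath_def[of "[]"] vwalk_def[of "[]"])
qed

section \<open>Visibility criteria for each type of pair\<close>

text \<open>The only shortest path runs through the vertex that subdivides the edge
  \<open>uv\<close>.\<close>

lemma visible_Inl_Inl:
  assumes "u \<in> V" "v \<in> V" "u \<noteq> v"
  shows "visible S X (Inl u) (Inl v) \<longleftrightarrow> Inr {u, v} \<notin> X"
proof -
  have path: "vpath [Inl u, Inr {u, v}, Inl v] S"
    using assms by (simp add: vpath_simps edge_iff)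
  have unique: "q = [Inl u, Inr {u, v}, Inl v]"
    if q: "vpath q S" "hd q = Inl u" "last q = Inl v" "length q = 3" for q
  proof -
    obtain x where x: "q = [Inl u, x, Inl v]"
      using q by (auto simp: length_Suc_conv numeral_eq_Suc)
    then obtain e where "x = Inr e"
      using q(1) by (cases x) (auto simp: vpath_simps)
    with q(1) x show ?thesis
      using edge_eq[of e u v] assms(3) by (auto simp: vpath_simps)
  qed
  have "visible S X (Inl u) (Inl v) \<longleftrightarrow> (\<exists>q. vpath q S \<and> hd q = Inl u \<and> last q = Inl v
      \<and> length q = 3 \<and> set q \<inter> X \<subseteq> {Inl u, Inl v})"
    by (rule visible_iff_of_distance[OF path])
      (use assms in \<open>auto intro: vpath_length_Inl_Inl\<close>)
  also have "\<dots> \<longleftrightarrow> set [Inl u, Inr {u, v}, Inl v] \<inter> X \<subseteq> {Inl u, Inl v}"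
    (is "?L \<longleftrightarrow> ?R")
  proof
    show ?R if ?L using that unique by blast
    show ?L if ?R using that path by (intro exI[of _ "[Inl u, Inr {u, v}, Inl v]"]) simp
  qed
  finally show ?thesis by auto
qed

text \<open>The two vertices are adjacent, so their shortest path has no inner vertex that
  \<open>X\<close> could block.\<close>

lemma visible_Inl_Inr_incident:
  assumes "e \<in> E" "u \<in> e"
  shows "visible S X (Inl u) (Inr e)" "visible S X (Inr e) (Inl u)"
proof -
  have len: "2 \<le> length q" if "vpath q H" "hd q \<noteq> last q" for q H
    \<comment> \<open>The rule serves to split \<open>q\<close> into empty, singleton and longer
      lists; the empty list is no walk, and a singleton has equal ends.\<close>
    using that by (cases q rule: remdups_adj.cases) (auto simp: vpath_def vwalk_def)
  have *: "visible H X a b" if "vpath [a, b] H" "a \<noteq> b" for H :: "('c, 'd) pre_digraph" and X a b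
    unfolding visible_def shortest_vpath_def
  proof (intro exI[of _ "[a, b]"] conjI allI impI)
    fix q assume "vpath q H \<and> hd q = a \<and> last q = b"
    then have "2 \<le> length q" using that(2) by (intro len) auto
    then show "vwalk_length [a, b] \<le> vwalk_length q" by simp
  qed (use that in auto)
  have "vpath [Inl u, Inr e] S" "vpath [Inr e, Inl u] S"
    using assms edge_subset by (auto simp: vpath_simps)
  then show "visible S X (Inl u) (Inr e)" "visible S X (Inr e) (Inl u)"
    by (auto intro: *)
qed

text \<open>The shortest paths have four vertices, one path for each end \<open>v\<close> of
  \<open>e\<close>: from \<open>u\<close> along the edge \<open>uv\<close>, then into
  \<open>e\<close>.\<close>

lemma visible_Inl_Inr:
  assumes "u \<in> V" "e \<in> E" "u \<notin> e"
  shows "visible S X (Inl u) (Inr e) \<longleftrightarrow> (\<exists>v\<in>e. Inl v \<notin> X \<and> Inr {u, v} \<notin> X)"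
proof -
  have path: "vpath [Inl u, Inr {u, v}, Inl v, Inr e] S" if "v \<in> e" for v
    using assms that edge_subset by (auto simp: vpath_simps edge_iff)
  have unique: "\<exists>v\<in>e. q = [Inl u, Inr {u, v}, Inl v, Inr e]"
    if q: "vpath q S" "hd q = Inl u" "last q = Inr e" "length q = 4" for q
  proof -
    obtain x y where x: "q = [Inl u, x, y, Inr e]"
      using q by (auto simp: length_Suc_conv numeral_eq_Suc)
    then obtain f where "x = Inr f"
      using q(1) by (cases x) (auto simp: vpath_simps)
    moreover obtain v where "y = Inl v"
      using q(1) x by (cases y) (auto simp: vpath_simps)
    ultimately show ?thesis
      using edge_eq[of f u v] q(1) x assms(3) by (auto simp: vpath_simps)
  qed
  obtain v where "v \<in> e" using assms(2) by (auto elim: edgeE)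
  have "visible S X (Inl u) (Inr e) \<longleftrightarrow> (\<exists>q. vpath q S \<and> hd q = Inl u \<and> last q = Inr e
      \<and> length q = 4 \<and> set q \<inter> X \<subseteq> {Inl u, Inr e})"
    by (rule visible_iff_of_distance[OF path[OF \<open>v \<in> e\<close>]])
      (use assms in \<open>auto intro: vpath_length_Inl_Inr\<close>)
  also have "\<dots> \<longleftrightarrow> (\<exists>v\<in>e. set [Inl u, Inr {u, v}, Inl v, Inr e] \<inter> X \<subseteq> {Inl u, Inr e})"
    (is "?L \<longleftrightarrow> ?R")
  proof
    show ?R if ?L using that unique by blast
    show ?L if ?R using that path by (elim bexE) (intro exI conjI, auto)
  qed
  \<comment> \<open>As \<open>u\<close> is not in \<open>e\<close>, neither inner vertex coincides
    with an end of the path, so both must avoid \<open>X\<close>.\<close>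
  also have "\<dots> \<longleftrightarrow> (\<exists>v\<in>e. Inl v \<notin> X \<and> Inr {u, v} \<notin> X)"
    using assms(3) by (intro bex_cong) auto
  finally show ?thesis .
qed

text \<open>Arcs come in opposite pairs, so reversal preserves paths and their lengths. Mixed pairs
  then have to be treated in one order only.\<close>

lemma visible_sym:
  assumes "visible S X a b"
  shows "visible S X b a"
proof -
  have arcs_rev: "set (vwalk_arcs (rev p)) = {(y, x). (x, y) \<in> set (vwalk_arcs p)}" for p :: "('a + 'a set) list"
  proof (induction p rule: vwalk_arcs.induct)
    case (3 x y p)
    have "set (vwalk_arcs (rev (x # y # p))) = insert (y, x) (set (vwalk_arcs (rev (y # p))))"
      using set_vwalk_arcs_snoc[of "rev (y # p)" x] by simp
    with 3 show ?case by auto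
  qed auto
  have sym: "(y, x) \<in> parcs (edge_subdivision G)" if "(x, y) \<in> parcs (edge_subdivision G)" for x y
    using that by (cases x; cases y) auto
  have "vpath (rev p) S" if "vpath p S" for p
    using that by (auto simp: vpath_def vwalk_def arcs_rev intro: sym)
  then have rev: "vpath (rev p) S \<longleftrightarrow> vpath p S" for p
    by (metis rev_rev_ident)
  have len: "vwalk_length (rev p) = vwalk_length p" for p :: "('a + 'a set) list"
    by simp
  have "shortest_vpath S b (rev p) a" if "shortest_vpath S a p b" for p
    using that unfolding shortest_vpath_def
    by (metis len rev hd_rev last_rev)
  moreover obtain p where "shortest_vpath S a p b" "set p \<inter> X \<subseteq> {a, b}"
    using assms by (auto simp: visible_def)
  ultimately show ?thesis
    unfolding visible_def by (intro exI[of _ "rev p"]) auto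
qed

text \<open>Distinct edges share at most one vertex, so the shortest path through \<open>u\<close>
  is unique.\<close>

lemma visible_Inr_Inr_adjacent:
  assumes "e \<in> E" "f \<in> E" "e \<noteq> f" "u \<in> e" "u \<in> f"
  shows "visible S X (Inr e) (Inr f) \<longleftrightarrow> Inl u \<notin> X"
proof -
  have path: "vpath [Inr e, Inl u, Inr f] S"
    using assms edge_subset by (auto simp: vpath_simps)
  have unique: "q = [Inr e, Inl u, Inr f]"
    if q: "vpath q S" "hd q = Inr e" "last q = Inr f" "length q = 3" for q
  proof -
    obtain x where x: "q = [Inr e, x, Inr f]"
      using q by (auto simp: length_Suc_conv numeral_eq_Suc)
    then obtain v where v: "x = Inl v"
      using q(1) by (cases x) (auto simp: vpath_simps)
    with q(1) x have "v \<in> e" "v \<in> f"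
      by (auto simp: vpath_simps)
    with v x show ?thesis
      using edge_eq[of e u v] edge_eq[of f u v] assms by auto
  qed
  have "visible S X (Inr e) (Inr f) \<longleftrightarrow> (\<exists>q. vpath q S \<and> hd q = Inr e \<and> last q = Inr f
      \<and> length q = 3 \<and> set q \<inter> X \<subseteq> {Inr e, Inr f})"
    by (rule visible_iff_of_distance[OF path])
      (use assms in \<open>auto intro: vpath_length_Inr_Inr\<close>)
  also have "\<dots> \<longleftrightarrow> set [Inr e, Inl u, Inr f] \<inter> X \<subseteq> {Inr e, Inr f}"
    (is "?L \<longleftrightarrow> ?R")
  proof
    show ?R if ?L using that unique by blast
    show ?L if ?R using that path by (intro exI[of _ "[Inr e, Inl u, Inr f]"]) simp
  qed
  finally show ?thesis by auto
qed

text \<open>A shortest path has five vertices and is determined by the end \<open>a\<close> where it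
  leaves \<open>e\<close> and the end \<open>b\<close> where it enters \<open>f\<close>;
  completeness of \<open>G\<close> supplies the edge between them.\<close>

lemma visible_Inr_Inr_disjoint:
  assumes "e \<in> E" "f \<in> E" "e \<inter> f = {}"
  shows "visible S X (Inr e) (Inr f) \<longleftrightarrow>
    (\<exists>a\<in>e. \<exists>b\<in>f. Inl a \<notin> X \<and> Inl b \<notin> X \<and> Inr {a, b} \<notin> X)"
proof -
  have ne: "e \<noteq> f" using assms by (auto elim: edgeE)
  have path: "vpath [Inr e, Inl a, Inr {a, b}, Inl b, Inr f] S" if "a \<in> e" "b \<in> f" for a b
    using assms that edge_subset ne by (auto simp: vpath_simps edge_iff)
  have unique: "\<exists>a\<in>e. \<exists>b\<in>f. q = [Inr e, Inl a, Inr {a, b}, Inl b, Inr f]"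
    if q: "vpath q S" "hd q = Inr e" "last q = Inr f" "length q = 5" for q
  proof -
    obtain x y z where x: "q = [Inr e, x, y, z, Inr f]"
      using q by (auto simp: length_Suc_conv numeral_eq_Suc)
    then obtain a where "x = Inl a"
      using q(1) by (cases x) (auto simp: vpath_simps)
    moreover obtain b where "z = Inl b"
      using q(1) x by (cases z) (auto simp: vpath_simps)
    moreover obtain g where "y = Inr g"
      using q(1) x calculation by (cases y) (auto simp: vpath_simps)
    ultimately show ?thesis
      using edge_eq[of g a b] q(1) x by (auto simp: vpath_simps)
  qed
  obtain a b where "a \<in> e" "b \<in> f" using assms by (auto elim!: edgeE)
  have "visible S X (Inr e) (Inr f) \<longleftrightarrow> (\<exists>q. vpath q S \<and> hd q = Inr e \<and> last q = Inr f
      \<and> length q = 5 \<and> set q \<inter> X \<subseteq> {Inr e, Inr f})"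
    by (rule visible_iff_of_distance[OF path[OF \<open>a \<in> e\<close> \<open>b \<in> f\<close>]])
      (use assms ne in \<open>auto intro: vpath_length_Inr_Inr_disjoint\<close>)
  also have "\<dots> \<longleftrightarrow> (\<exists>a\<in>e. \<exists>b\<in>f. set [Inr e, Inl a, Inr {a, b}, Inl b, Inr f] \<inter> X \<subseteq> {Inr e, Inr f})"
    (is "?L \<longleftrightarrow> ?R")
  proof
    show ?R if ?L using that unique by blast
    show ?L if ?R using that path by (elim bexE) (intro exI conjI, auto)
  qed
  \<comment> \<open>By disjointness \<open>{a, b}\<close> is neither \<open>e\<close> nor
    \<open>f\<close>, so the exemption of the path's ends covers no inner vertex.\<close>
  also have "\<dots> \<longleftrightarrow> (\<exists>a\<in>e. \<exists>b\<in>f. Inl a \<notin> X \<and> Inl b \<notin> X \<and> Inr {a, b} \<notin> X)"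
    using assms(3) by (intro bex_cong) auto
  finally show ?thesis .
qed

section \<open>Mutual visibility as a combinatorial condition\<close>

text \<open>The four clauses collect the criteria above for two original vertices, an original
  vertex and a non-incident edge, two adjacent edges, and two disjoint edges. Incident pairs are
  always visible and contribute no clause.\<close>

lemma mutual_visibility_set_iff:
  "mutual_visibility_set S X \<longleftrightarrow> X \<subseteq> pverts (edge_subdivision G) \<and>
    (\<forall>u v. Inl u \<in> X \<longrightarrow> Inl v \<in> X \<longrightarrow> u \<noteq> v \<longrightarrow> Inr {u, v} \<notin> X) \<and>
    (\<forall>u e. Inl u \<in> X \<longrightarrow> Inr e \<in> X \<longrightarrow> u \<notin> e \<longrightarrow> (\<exists>v\<in>e. Inl v \<notin> X \<and> Inr {u, v} \<notin> X)) \<and>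
    (\<forall>e f u. Inr e \<in> X \<longrightarrow> Inr f \<in> X \<longrightarrow> e \<noteq> f \<longrightarrow> u \<in> e \<longrightarrow> u \<in> f \<longrightarrow> Inl u \<notin> X) \<and>
    (\<forall>e f. Inr e \<in> X \<longrightarrow> Inr f \<in> X \<longrightarrow> e \<inter> f = {} \<longrightarrow>
      (\<exists>a\<in>e. \<exists>b\<in>f. Inl a \<notin> X \<and> Inl b \<notin> X \<and> Inr {a, b} \<notin> X))"
  (is "_ \<longleftrightarrow> ?sub \<and> ?LL \<and> ?LR \<and> ?RRa \<and> ?RRd")
proof
  assume mv: "mutual_visibility_set S X"
  then have vis: "visible S X a b" if "a \<in> X" "b \<in> X" "a \<noteq> b" for a b
    using that by (auto simp: mutual_visibility_set_def)
  from mv have sub: ?sub by (simp add: mutual_visibility_set_def)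
  then have V: "u \<in> V" if "Inl u \<in> X" for u using that by (metis subsetD verts_S(1))
  from sub have E: "e \<in> E" if "Inr e \<in> X" for e using that by (metis subsetD verts_S(2))
  have ?LL
    using vis visible_Inl_Inl V by (metis Inl_inject)
  moreover have ?LR
    using vis visible_Inl_Inr V E by (metis Inl_Inr_False)
  moreover have ?RRa
    using vis visible_Inr_Inr_adjacent E by (metis Inr_inject)
  moreover have ?RRd
  proof (intro allI impI)
    fix e f assume ef: "Inr e \<in> X" "Inr f \<in> X" "e \<inter> f = {}"
    then have "e \<noteq> f" using E by (auto elim: edgeE)
    with ef vis show "\<exists>a\<in>e. \<exists>b\<in>f. Inl a \<notin> X \<and> Inl b \<notin> X \<and> Inr {a, b} \<notin> X"
      using visible_Inr_Inr_disjoint E by blast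
  qed
  ultimately show "?sub \<and> ?LL \<and> ?LR \<and> ?RRa \<and> ?RRd" using sub by blast
next
  assume R: "?sub \<and> ?LL \<and> ?LR \<and> ?RRa \<and> ?RRd"
  then have V: "u \<in> V" if "Inl u \<in> X" for u using that by (metis subsetD verts_S(1))
  from R have E: "e \<in> E" if "Inr e \<in> X" for e using that by (metis subsetD verts_S(2))
  have LR: "visible S X (Inl u) (Inr e)" if "Inl u \<in> X" "Inr e \<in> X" for u e
  proof (cases "u \<in> e")
    case True
    then show ?thesis using that E visible_Inl_Inr_incident(1) by simp
  next
    case False
    then show ?thesis using that R V E by (simp add: visible_Inl_Inr)
  qed
  have RR: "visible S X (Inr e) (Inr f)" if "Inr e \<in> X" "Inr f \<in> X" "e \<noteq> f" for e f
  proof (cases "e \<inter> f = {}")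
    case True
    then show ?thesis using that R E by (simp add: visible_Inr_Inr_disjoint)
  next
    case False
    then obtain u where "u \<in> e" "u \<in> f" by blast
    moreover have ?RRa using R by (elim conjE)
    ultimately have "Inl u \<notin> X" using that by blast
    with \<open>u \<in> e\<close> \<open>u \<in> f\<close> that show ?thesis
      using E by (simp add: visible_Inr_Inr_adjacent[of e f u])
  qed
  have "visible S X a b" if "a \<in> X" "b \<in> X" "a \<noteq> b" for a b
  proof (cases a; cases b)
    fix u v assume "a = Inl u" "b = Inl v"
    then show ?thesis using that R V by (simp add: visible_Inl_Inl)
  qed (use that LR RR visible_sym in auto)
  with R show "mutual_visibility_set S X"
    by (simp add: mutual_visibility_set_def)
qed

section \<open>Extending a small mutual-visibility set\<close>

text \<open>Edges of \<open>F\<close> never leave \<open>T\<close>, and \<open>T\<close> avoids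
  \<open>U\<close>, so routes between \<open>T\<close> and its complement meet no vertex of
  \<open>F\<close>. Within \<open>T\<close>, the degree of \<open>w\<close> and the absence of
  triangles keep a route open.\<close>

lemma mutual_visibility_set_extendable:
  assumes mv: "mutual_visibility_set S X" and card: "card X < n"
  obtains w where "Inl w \<notin> X" "mutual_visibility_set S (insert (Inl w) X)"
proof -
  define U where "U = {u. Inl u \<in> X}"
  define F where "F = {e. Inr e \<in> X}"
  have sub: "X \<subseteq> pverts (edge_subdivision G)"
    using mv by (simp add: mutual_visibility_set_def)
  have FE: "e \<in> E" if "e \<in> F" for e
    using subsetD[OF sub, of "Inr e"] that by (simp add: F_def)
  have "finite X"
    using sub finite_verts_S by (rule finite_subset)
  have "X = Inl ` U \<union> Inr ` F"
  proof (intro set_eqI)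
    fix x show "x \<in> X \<longleftrightarrow> x \<in> Inl ` U \<union> Inr ` F"
      by (cases x) (auto simp: U_def F_def)
  qed
  moreover from this have fin: "finite U" "finite F"
    using \<open>finite X\<close> by (auto simp: finite_image_iff)
  ultimately have "card X = card (Inl ` U :: ('a + 'a set) set) + card (Inr ` F :: ('a + 'a set) set)"
    by (auto intro: card_Un_disjoint)
  then have "card X = card U + card F"
    by (simp add: card_image)
  then have sparse: "card U + card F < card V"
    using card card_V by simp
  have card2: "card e = 2" if "e \<in> F" for e
    using that FE card_edge by auto
  obtain T w where T: "T \<subseteq> V" "T \<inter> U = {}" "w \<in> T"
      and closed: "\<forall>e\<in>F. e \<inter> T \<noteq> {} \<longrightarrow> e \<subseteq> T"
      and leaf: "\<forall>e\<in>F. \<forall>f\<in>F. w \<in> e \<longrightarrow> w \<in> f \<longrightarrow> e = f"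
      and no_triangle: "\<forall>x\<in>T. \<forall>y z. {x, y} \<in> F \<longrightarrow> {x, z} \<in> F \<longrightarrow> {y, z} \<notin> F"
    by (rule sparse_graph_leaf[OF finite_V fin card2 sparse])
  have mv': "\<And>u v. u \<in> U \<Longrightarrow> v \<in> U \<Longrightarrow> u \<noteq> v \<Longrightarrow> {u, v} \<notin> F"
      "\<And>u e. u \<in> U \<Longrightarrow> e \<in> F \<Longrightarrow> u \<notin> e \<Longrightarrow> \<exists>v\<in>e. v \<notin> U \<and> {u, v} \<notin> F"
      "\<And>e f u. e \<in> F \<Longrightarrow> f \<in> F \<Longrightarrow> e \<noteq> f \<Longrightarrow> u \<in> e \<Longrightarrow> u \<in> f \<Longrightarrow> u \<notin> U"
      "\<And>e f. e \<in> F \<Longrightarrow> f \<in> F \<Longrightarrow> e \<inter> f = {} \<Longrightarrow> \<exists>a\<in>e. \<exists>b\<in>f. a \<notin> U \<and> b \<notin> U \<and> {a, b} \<notin> F"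
    using mv by (simp_all add: mutual_visibility_set_iff U_def F_def)
  \<comment> \<open>Two ends in \<open>U\<close> would be blocked from each other by
    \<open>e\<close> itself.\<close>
  have free_end: "\<exists>v\<in>e. v \<notin> U" if e: "e \<in> F" for e
  proof -
    obtain u v where "e = {u, v}" "u \<noteq> v" using edgeE[OF FE[OF e]] by metis
    with mv'(1) e show ?thesis by auto
  qed
  have closed': "b \<in> T" if "{a, b} \<in> F" "a \<in> T" for a b
    using bspec[OF closed that(1)] that(2) by auto
  have LL: "{w, v} \<notin> F" if "v \<in> U" for v
    using that closed'[of w v] T by blast
  \<comment> \<open>If \<open>e\<close> lies outside \<open>T\<close>, any end not in
    \<open>U\<close> serves. If it lies inside, both ends avoid \<open>U\<close>, and
    \<open>w\<close> cannot be joined by \<open>F\<close> to both of them.\<close>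
  have LR_new: "\<exists>v\<in>e. v \<notin> insert w U \<and> {w, v} \<notin> F" if e: "e \<in> F" "w \<notin> e" for e
  proof (cases "e \<inter> T = {}")
    case True
    obtain v where v: "v \<in> e" "v \<notin> U" using free_end[OF e(1)] by (elim bexE)
    then have "{w, v} \<notin> F" using closed'[of w v] T(3) True by auto
    moreover have "v \<noteq> w" using v(1) e(2) by auto
    ultimately show ?thesis using v by auto
  next
    case False
    then have "e \<subseteq> T" using bspec[OF closed e(1)] by simp
    obtain x y where xy: "e = {x, y}" "x \<noteq> y" using edgeE[OF FE[OF e(1)]] by metis
    have "{w, x} \<noteq> {w, y}" using xy(2) by (auto simp: doubleton_eq_iff)
    then have "{w, x} \<notin> F \<or> {w, y} \<notin> F" using leaf insertI1 by metis
    then show ?thesis using xy e(2) \<open>e \<subseteq> T\<close> T(2) by auto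
  qed
  \<comment> \<open>Adding \<open>w\<close> closes only routes through \<open>w\<close>. In that
    case the other end of \<open>e\<close> lies in \<open>T\<close>, hence outside \<open>U\<close>,
    and no edge of \<open>F\<close> joins it to \<open>u\<close>.\<close>
  have LR_old: "\<exists>v\<in>e. v \<notin> insert w U \<and> {u, v} \<notin> F" if e: "u \<in> U" "e \<in> F" "u \<notin> e" for u e
  proof (cases "w \<in> e")
    case False
    with mv'(2)[OF e] show ?thesis by (metis insertE)
  next
    case True
    then obtain x where x: "e = {w, x}" "x \<noteq> w"
      using edge_other_end[OF FE[OF e(2)] True] by metis
    then have "x \<in> T" using e(2) T(3) closed'[of w x] by simp
    moreover have "{u, x} \<notin> F"
      using closed'[of x u] \<open>x \<in> T\<close> e(1) T(2) by (auto simp: insert_commute)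
    ultimately show ?thesis using x T(2) by auto
  qed
  \<comment> \<open>The route must leave \<open>e\<close> at its other end \<open>x\<close>. If
    \<open>f\<close> lies in \<open>T\<close> and \<open>x\<close> were joined by \<open>F\<close>
    to both its ends, these edges and \<open>f\<close> would form a triangle.\<close>
  have RRd_w: "\<exists>a\<in>e. \<exists>b\<in>f. a \<notin> insert w U \<and> b \<notin> insert w U \<and> {a, b} \<notin> F"
    if ef: "e \<in> F" "f \<in> F" "e \<inter> f = {}" "w \<in> e" for e f
  proof -
    obtain x where x: "e = {w, x}" "x \<noteq> w"
      using edge_other_end[OF FE[OF ef(1)] ef(4)] by metis
    then have "x \<in> T" using ef(1) T(3) closed'[of w x] by simp
    have "\<exists>b\<in>f. b \<notin> U \<and> {x, b} \<notin> F"
    proof (cases "f \<inter> T = {}")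
      case True
      obtain v where v: "v \<in> f" "v \<notin> U" using free_end[OF ef(2)] by (elim bexE)
      then have "{x, v} \<notin> F" using closed'[of x v] \<open>x \<in> T\<close> True by auto
      with v show ?thesis by auto
    next
      case False
      then have "f \<subseteq> T" using bspec[OF closed ef(2)] by simp
      obtain y z where yz: "f = {y, z}" using edgeE[OF FE[OF ef(2)]] by metis
      then have "{x, y} \<notin> F \<or> {x, z} \<notin> F"
        using no_triangle \<open>x \<in> T\<close> ef(2) by metis
      then show ?thesis using yz \<open>f \<subseteq> T\<close> T(2) by auto
    qed
    then show ?thesis using x ef(3) \<open>x \<in> T\<close> T(2) by auto
  qed
  have RRd: "\<exists>a\<in>e. \<exists>b\<in>f. a \<notin> insert w U \<and> b \<notin> insert w U \<and> {a, b} \<notin> F"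
    if ef: "e \<in> F" "f \<in> F" "e \<inter> f = {}" for e f
  proof -
    consider "w \<in> e" | "w \<in> f" | "w \<notin> e" "w \<notin> f" by blast
    then show ?thesis
    proof cases
      case 1
      then show ?thesis using RRd_w ef by simp
    next
      case 2
      then have "\<exists>b\<in>f. \<exists>a\<in>e. b \<notin> insert w U \<and> a \<notin> insert w U \<and> {b, a} \<notin> F"
        using RRd_w[of f e] ef by (simp add: Int_commute)
      then show ?thesis by (metis insert_commute)
    next
      case 3
      then show ?thesis using mv'(4)[OF ef] by (metis insertE)
    qed
  qed
  have memb: "Inl u \<in> insert (Inl w) X \<longleftrightarrow> u \<in> insert w U"
      "Inr e \<in> insert (Inl w) X \<longleftrightarrow> e \<in> F" for u e
    by (auto simp: U_def F_def)
  have "insert (Inl w) X \<subseteq> pverts (edge_subdivision G)"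
    using sub T by auto
  moreover have "{u, v} \<notin> F" if "u \<in> insert w U" "v \<in> insert w U" "u \<noteq> v" for u v
    using that LL mv'(1) by (auto simp: insert_commute)
  moreover have "\<exists>v\<in>e. v \<notin> insert w U \<and> {u, v} \<notin> F" if "u \<in> insert w U" "e \<in> F" "u \<notin> e" for u e
    using that LR_new LR_old by auto
  \<comment> \<open>The new vertex cannot block two adjacent edges, as at most one edge of
    \<open>F\<close> contains \<open>w\<close>.\<close>
  moreover have "u \<notin> insert w U" if "e \<in> F" "f \<in> F" "e \<noteq> f" "u \<in> e" "u \<in> f" for e f u
    using that mv'(3) leaf by (metis insertE)
  ultimately have "mutual_visibility_set S (insert (Inl w) X)"
    unfolding mutual_visibility_set_iff memb using RRd by presburger
  moreover have "Inl w \<notin> X"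
    using T by (auto simp: U_def)
  ultimately show thesis using that by blast
qed

section \<open>The lower mutual-visibility number\<close>

lemma mutual_visibility_set_Inl_V: "mutual_visibility_set S (Inl ` V)"
  by (auto simp: mutual_visibility_set_iff)

text \<open>Any further vertex subdivides some edge \<open>uv\<close> and blocks the only shortest
  path between \<open>u\<close> and \<open>v\<close>.\<close>

lemma maximal_mutual_visibility_set_Inl_V: "maximal_set (mutual_visibility_set S) (Inl ` V)"
  unfolding maximal_set_def
proof (intro conjI allI impI notI)
  show "mutual_visibility_set S (Inl ` V)" by (rule mutual_visibility_set_Inl_V)
next
  fix Y assume Y: "Inl ` V \<subset> Y" "mutual_visibility_set S Y"
  then obtain y where y: "y \<in> Y" "y \<notin> Inl ` V" by blast
  moreover have "y \<in> pverts (edge_subdivision G)"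
    using Y y by (auto simp: mutual_visibility_set_def)
  ultimately obtain e where "y = Inr e" "e \<in> E" by (cases y) auto
  then obtain u v where "y = Inr {u, v}" "u \<in> V" "v \<in> V" "u \<noteq> v" by (auto elim: edgeE)
  moreover have "visible S Y (Inl u) (Inl v)"
    using Y \<open>u \<in> V\<close> \<open>v \<in> V\<close> \<open>u \<noteq> v\<close> unfolding mutual_visibility_set_def by blast
  ultimately show False using y(1) by (simp add: visible_Inl_Inl)
qed

text \<open>Finiteness is what gives \<open>Min\<close> its intended meaning.\<close>

lemma finite_maximal_sets:
  assumes "\<And>X. P X \<Longrightarrow> X \<subseteq> pverts (edge_subdivision G)"
  shows "finite {X. maximal_set P X}"
  by (rule finite_subset[of _ "Pow (pverts (edge_subdivision G))"])
    (auto simp: maximal_set_def finite_verts_S dest: assms)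

lemma lower_mu_eq: "lower_mu S = n"
  unfolding lower_mu_def
proof (rule Min_eqI)
  show "finite (card ` {X. maximal_set (mutual_visibility_set S) X})"
    by (intro finite_imageI finite_maximal_sets) (simp add: mutual_visibility_set_def)
  have "card (Inl ` V :: ('a + 'a set) set) = n"
    by (simp add: card_image card_V)
  then show "n \<in> card ` {X. maximal_set (mutual_visibility_set S) X}"
    using maximal_mutual_visibility_set_Inl_V by force
next
  fix k assume "k \<in> card ` {X. maximal_set (mutual_visibility_set S) X}"
  then obtain X where X: "maximal_set (mutual_visibility_set S) X" "k = card X" by blast
  show "n \<le> k"
  proof (rule ccontr)
    assume "\<not> n \<le> k"
    then obtain w where "Inl w \<notin> X" "mutual_visibility_set S (insert (Inl w) X)"
      using mutual_visibility_set_extendable[of X] X by (auto simp: maximal_set_def)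
    with X show False unfolding maximal_set_def by blast
  qed
qed

section \<open>Total mutual visibility\<close>

text \<open>With nothing blocked, each criterion only asks that edges have ends to route
  through.\<close>

lemma total_mutual_visibility_set_empty: "total_mutual_visibility_set S {}"
proof -
  have LR: "visible S {} (Inl u) (Inr e)" if "u \<in> V" "e \<in> E" for u e
  proof (cases "u \<in> e")
    case True
    then show ?thesis using that visible_Inl_Inr_incident(1) by simp
  next
    case False
    then show ?thesis using that by (auto simp: visible_Inl_Inr elim: edgeE)
  qed
  have RR: "visible S {} (Inr e) (Inr f)" if "e \<in> E" "f \<in> E" "e \<noteq> f" for e f
  proof (cases "e \<inter> f = {}")
    case True
    then show ?thesis using that by (auto simp: visible_Inr_Inr_disjoint elim!: edgeE)
  next
    case False
    then obtain u where "u \<in> e" "u \<in> f" by blast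
    then show ?thesis using that by (simp add: visible_Inr_Inr_adjacent[of e f u])
  qed
  have "visible S {} a b"
    if "a \<in> pverts (edge_subdivision G)" "b \<in> pverts (edge_subdivision G)" "a \<noteq> b" for a b
  proof (cases a; cases b)
    fix u v assume "a = Inl u" "b = Inl v"
    then show ?thesis using that by (simp add: visible_Inl_Inl)
  qed (use that LR RR visible_sym in auto)
  then show ?thesis by (simp add: total_mutual_visibility_set_def)
qed

lemma total_mutual_visibility_set_imp_empty:
  assumes "n \<ge> 3" "total_mutual_visibility_set S X"
  shows "X = {}"
proof (rule ccontr)
  assume "X \<noteq> {}"
  then obtain x where x: "x \<in> X" by blast
  have sub: "X \<subseteq> pverts (edge_subdivision G)"
    using assms(2) by (simp add: total_mutual_visibility_set_def)
  have vis: "visible S X a b" if "a \<in> pverts (edge_subdivision G)" "b \<in> pverts (edge_subdivision G)" "a \<noteq> b" for a b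
    using assms(2) that by (auto simp: total_mutual_visibility_set_def)
  show False
  proof (cases x)
    case (Inl u)
    then have u: "u \<in> V" using sub x by auto
    \<comment> \<open>Here \<open>n \<ge> 3\<close> enters: two further vertices give two edges at
      \<open>u\<close>, whose subdivision vertices see each other only through
      \<open>Inl u\<close>.\<close>
    then have "card (V - {u}) \<ge> 2" using assms(1) card_V finite_V by simp
    then obtain v w where vw: "v \<in> V" "w \<in> V" "v \<noteq> u" "w \<noteq> u" "v \<noteq> w"
      by (metis DiffE card_le_Suc0_iff_eq card_V finite_V finite_Diff not_less_eq_eq numeral_2_eq_2 singletonI)
    then have "{u, v} \<in> E" "{u, w} \<in> E" "{u, v} \<noteq> {u, w}"
      using u by (auto simp: edge_iff doubleton_eq_iff)
    then show False
      using vis[of "Inr {u, v}" "Inr {u, w}"] visible_Inr_Inr_adjacent[of "{u, v}" "{u, w}" u X] x Inl by auto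
  next
    case (Inr e)
    then have "e \<in> E" using sub x by auto
    then obtain u v where "e = {u, v}" "u \<in> V" "v \<in> V" "u \<noteq> v" by (rule edgeE)
    then show False using vis[of "Inl u" "Inl v"] visible_Inl_Inl x Inr by auto
  qed
qed

text \<open>The empty set is the only total mutual-visibility set, hence the only maximal
  one.\<close>

lemma lower_mu_t_eq:
  assumes "n \<ge> 3"
  shows "lower_mu_t S = 0"
proof -
  have "maximal_set (total_mutual_visibility_set S) X \<longleftrightarrow> X = {}" for X
    using total_mutual_visibility_set_imp_empty[OF assms] total_mutual_visibility_set_empty
    unfolding maximal_set_def by blast
  then show ?thesis by (simp add: lower_mu_t_def)
qed

end

theorem theorem5p2:
  fixes n :: nat and G :: "'a pair_pre_digraph"
  assumes "n \<ge> 3"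
    and "complete_digraph n (with_proj G)"
  shows "lower_mu_t (with_proj (edge_subdivision G)) = 0
    \<and> lower_mu (with_proj (edge_subdivision G)) = n"
proof -
  interpret complete_subdivision n G
    by unfold_locales (rule assms(2))
  show ?thesis
    using lower_mu_t_eq[OF assms(1)] lower_mu_eq by simp
qed

end
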